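(* The nucleus, and therefore the center, of free Steiner loops are trivial.
   Context: A Steiner loop is a commutative loop with identity $e$ satisfying $x\cdot x=e$ and $x\cdot(x\cdot y)=y$ for all $x,y$ (equivalently, a diassociative loop of exponent $2$). Steiner loops form a variety; a free Steiner loop $S(X)$ is the free object of this variety with a finite set $X$ of free generators. For a loop $L$ put $N_l(L)=\{u:(u\cdot x)\cdot y=u\cdot(x\cdot y)\ \forall x,y\in L\}$, $N_r(L)=\{u:(x\cdot y)\cdot u=x\cdot(y\cdot u)\ \forall x,y\in L\}$, $N_m(L)=\{u:(x\cdot u)\cdot y=x\cdot(u\cdot y)\ \forall x,y\in L\}$. The nucleus is $N(L)=N_l(L)\cap N_r(L)\cap N_m(L)$. The commutant $C(L)$ is the set of all $c\in L$ with $c\cdot x=x\cdot c$ for all $x\in L$, and the center is $Z(L)=C(L)\cap N(L)$. Trivial means equal to $\{e\}$.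
   Formalization: The number of free generators is assumed to be different from 1 and 2, since on one or two free generators the free Steiner loop is the group Z/2 or (Z/2)^2, whose nucleus and center are the whole loop. *)

theory Defs
  imports "HOL-Algebra.Group" "HOL-Library.Countable_Set"
begin

(* HOL-Algebra's monoid record is only the signature (carrier, mult, one);
   associativity is not assumed. *)
locale loop =
  fixes L (structure)
  assumes m_closed: "\<lbrakk>x \<in> carrier L; y \<in> carrier L\<rbrakk> \<Longrightarrow> x \<otimes> y \<in> carrier L"
    and one_closed: "\<one> \<in> carrier L"
    and l_one: "x \<in> carrier L \<Longrightarrow> \<one> \<otimes> x = x"
    and r_one: "x \<in> carrier L \<Longrightarrow> x \<otimes> \<one> = x"
    and l_div: "\<lbrakk>x \<in> carrier L; y \<in> carrier L\<rbrakk> \<Longrightarrow> \<exists>!z. z \<in> carrier L \<and> x \<otimes> z = y"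
    and r_div: "\<lbrakk>x \<in> carrier L; y \<in> carrier L\<rbrakk> \<Longrightarrow> \<exists>!z. z \<in> carrier L \<and> z \<otimes> x = y"

locale steiner_loop = loop +
  assumes comm: "\<lbrakk>x \<in> carrier L; y \<in> carrier L\<rbrakk> \<Longrightarrow> x \<otimes> y = y \<otimes> x"
    and square: "x \<in> carrier L \<Longrightarrow> x \<otimes> x = \<one>"
    and l_cancel_twice: "\<lbrakk>x \<in> carrier L; y \<in> carrier L\<rbrakk> \<Longrightarrow> x \<otimes> (x \<otimes> y) = y"

definition left_nucleus :: "('a, 'm) monoid_scheme \<Rightarrow> 'a set" where
  "left_nucleus L = {u \<in> carrier L. \<forall>x \<in> carrier L. \<forall>y \<in> carrier L.
     (u \<otimes>\<^bsub>L\<^esub> x) \<otimes>\<^bsub>L\<^esub> y = u \<otimes>\<^bsub>L\<^esub> (x \<otimes>\<^bsub>L\<^esub> y)}"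

definition right_nucleus :: "('a, 'm) monoid_scheme \<Rightarrow> 'a set" where
  "right_nucleus L = {u \<in> carrier L. \<forall>x \<in> carrier L. \<forall>y \<in> carrier L.
     (x \<otimes>\<^bsub>L\<^esub> y) \<otimes>\<^bsub>L\<^esub> u = x \<otimes>\<^bsub>L\<^esub> (y \<otimes>\<^bsub>L\<^esub> u)}"

definition middle_nucleus :: "('a, 'm) monoid_scheme \<Rightarrow> 'a set" where
  "middle_nucleus L = {u \<in> carrier L. \<forall>x \<in> carrier L. \<forall>y \<in> carrier L.
     (x \<otimes>\<^bsub>L\<^esub> u) \<otimes>\<^bsub>L\<^esub> y = x \<otimes>\<^bsub>L\<^esub> (u \<otimes>\<^bsub>L\<^esub> y)}"

definition nucleus :: "('a, 'm) monoid_scheme \<Rightarrow> 'a set" where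
  "nucleus L = left_nucleus L \<inter> right_nucleus L \<inter> middle_nucleus L"

definition commutant :: "('a, 'm) monoid_scheme \<Rightarrow> 'a set" where
  "commutant L = {c \<in> carrier L. \<forall>x \<in> carrier L. c \<otimes>\<^bsub>L\<^esub> x = x \<otimes>\<^bsub>L\<^esub> c}"

definition loop_center :: "('a, 'm) monoid_scheme \<Rightarrow> 'a set" where
  "loop_center L = commutant L \<inter> nucleus L"

(* The last two conjuncts are closure under left and right division. *)
definition subloop :: "'a set \<Rightarrow> ('a, 'm) monoid_scheme \<Rightarrow> bool" where
  "subloop H L \<longleftrightarrow> H \<subseteq> carrier L \<and> \<one>\<^bsub>L\<^esub> \<in> H \<and>
     (\<forall>x \<in> H. \<forall>y \<in> H. x \<otimes>\<^bsub>L\<^esub> y \<in> H) \<and>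
     (\<forall>x \<in> H. \<forall>z \<in> carrier L. x \<otimes>\<^bsub>L\<^esub> z \<in> H \<longrightarrow> z \<in> H) \<and>
     (\<forall>x \<in> H. \<forall>z \<in> carrier L. z \<otimes>\<^bsub>L\<^esub> x \<in> H \<longrightarrow> z \<in> H)"

definition generated_subloop :: "('a, 'm) monoid_scheme \<Rightarrow> 'a set \<Rightarrow> 'a set" where
  "generated_subloop L X = \<Inter> {H. subloop H L \<and> X \<subseteq> H}"

(* An assumption cannot quantify over types, so the universal property is
   assumed for Steiner loops whose elements are natural numbers. As X is
   finite this loses nothing: the lemma unique_extension below derives the
   universal property for Steiner loops over an arbitrary type. *)
locale free_steiner_loop = steiner_loop L
  for L :: "('a, 'm) monoid_scheme" (structure) +
  fixes X :: "'a set"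
  assumes finite_gens: "finite X"
    and gens_closed: "X \<subseteq> carrier L"
    and generates: "generated_subloop L X = carrier L"
    and extension: "\<And>(M :: nat monoid) f. \<lbrakk>steiner_loop M; f \<in> X \<rightarrow> carrier M\<rbrakk>
          \<Longrightarrow> \<exists>h \<in> hom L M. \<forall>x \<in> X. h x = f x"

lemma (in steiner_loop) subloopI:
  assumes "H \<subseteq> carrier L" "\<one> \<in> H" "\<And>x y. \<lbrakk>x \<in> H; y \<in> H\<rbrakk> \<Longrightarrow> x \<otimes> y \<in> H"
  shows "subloop H L"
proof -
  have 1: "z \<in> H" if "x \<in> H" "z \<in> carrier L" "x \<otimes> z \<in> H" for x z
    using assms(1) assms(3)[OF that(1,3)] l_cancel_twice[of x z] that by auto
  have 2: "z \<in> H" if "x \<in> H" "z \<in> carrier L" "z \<otimes> x \<in> H" for x z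
    using 1[of x z] assms(1) comm[of z x] that by auto
  show ?thesis
    unfolding subloop_def using assms 1 2 by blast
qed

lemma (in steiner_loop) countable_closure:
  assumes "countable Y" "Y \<subseteq> carrier L"
  shows "\<exists>C. countable C \<and> Y \<subseteq> C \<and> C \<subseteq> carrier L \<and> \<one> \<in> C
    \<and> (\<forall>x\<in>C. \<forall>y\<in>C. x \<otimes> y \<in> C)"
proof -
  define step where "step A = A \<union> (\<lambda>(x, y). x \<otimes> y) ` (A \<times> A)" for A
  define C where "C = (\<Union>n. (step ^^ n) (insert \<one> Y))"
  have step_ext: "A \<subseteq> step A" for A
    unfolding step_def by blast
  have step_mult: "x \<otimes> y \<in> step A" if "x \<in> A" "y \<in> A" for x y A
    using that unfolding step_def by blast
  have step_closed: "countable (step A) \<and> step A \<subseteq> carrier L"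
    if "countable A \<and> A \<subseteq> carrier L" for A
    using that by (auto simp: step_def intro!: m_closed)
  have st: "countable ((step ^^ n) (insert \<one> Y)) \<and> (step ^^ n) (insert \<one> Y) \<subseteq> carrier L" for n
  proof (induction n)
    case 0
    then show ?case using assms one_closed by auto
  next
    case (Suc n)
    from step_closed[OF this] show ?case by simp
  qed
  have mono: "(step ^^ n) (insert \<one> Y) \<subseteq> (step ^^ m) (insert \<one> Y)" if "n \<le> m" for n m
    using that
  proof (induction m rule: dec_induct)
    case (step m)
    then show ?case using step_ext[of "(step ^^ m) (insert \<one> Y)"] by simp
  qed simp
  have closed: "x \<otimes> y \<in> C" if xy: "x \<in> C" "y \<in> C" for x y
  proof -
    obtain i j where ij: "x \<in> (step ^^ i) (insert \<one> Y)" "y \<in> (step ^^ j) (insert \<one> Y)"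
      using xy unfolding C_def by blast
    have "x \<in> (step ^^ max i j) (insert \<one> Y)" "y \<in> (step ^^ max i j) (insert \<one> Y)"
      using mono[of i "max i j"] mono[of j "max i j"] ij by auto
    from step_mult[OF this] have "x \<otimes> y \<in> (step ^^ Suc (max i j)) (insert \<one> Y)"
      by simp
    then show ?thesis unfolding C_def by blast
  qed
  have "insert \<one> Y \<subseteq> (step ^^ 0) (insert \<one> Y)" by simp
  then have "insert \<one> Y \<subseteq> C" unfolding C_def by blast
  moreover have "countable C" "C \<subseteq> carrier L"
    using st unfolding C_def by (simp_all add: UN_subset_iff)
  ultimately show ?thesis using closed by (intro exI[of _ C]) simp
qed

lemma steiner_loopI:
  fixes M (structure)
  assumes "\<And>x y. \<lbrakk>x \<in> carrier M; y \<in> carrier M\<rbrakk> \<Longrightarrow> x \<otimes> y \<in> carrier M"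
    and "\<one> \<in> carrier M"
    and "\<And>x. x \<in> carrier M \<Longrightarrow> \<one> \<otimes> x = x"
    and "\<And>x y. \<lbrakk>x \<in> carrier M; y \<in> carrier M\<rbrakk> \<Longrightarrow> x \<otimes> y = y \<otimes> x"
    and "\<And>x. x \<in> carrier M \<Longrightarrow> x \<otimes> x = \<one>"
    and "\<And>x y. \<lbrakk>x \<in> carrier M; y \<in> carrier M\<rbrakk> \<Longrightarrow> x \<otimes> (x \<otimes> y) = y"
  shows "steiner_loop M"
proof
  show l: "\<exists>!z. z \<in> carrier M \<and> x \<otimes> z = y" if "x \<in> carrier M" "y \<in> carrier M" for x y
  proof (rule ex1I[of _ "x \<otimes> y"])
    show "x \<otimes> y \<in> carrier M \<and> x \<otimes> (x \<otimes> y) = y" using assms that by blast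
    show "z = x \<otimes> y" if "z \<in> carrier M \<and> x \<otimes> z = y" for z
      using assms(6)[of x z] \<open>x \<in> carrier M\<close> that by auto
  qed
  show "\<exists>!z. z \<in> carrier M \<and> z \<otimes> x = y" if xy: "x \<in> carrier M" "y \<in> carrier M" for x y
  proof -
    have "(z \<in> carrier M \<and> z \<otimes> x = y) = (z \<in> carrier M \<and> x \<otimes> z = y)" for z
      using assms(4)[of x z] xy by auto
    then show ?thesis using l[OF xy] by simp
  qed
  show "x \<otimes> \<one> = x" if "x \<in> carrier M" for x
    using assms(4)[OF that assms(2)] assms(3)[OF that] by (rule trans)
qed (fact assms)+

lemma (in free_steiner_loop) extension_any:
  fixes M :: "('b, 'n) monoid_scheme"
  assumes M: "steiner_loop M" and f: "f \<in> X \<rightarrow> carrier M"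
  shows "\<exists>h \<in> hom L M. \<forall>x \<in> X. h x = f x"
proof -
  interpret M: steiner_loop M by (rule M)
  have "countable (f ` X)" "f ` X \<subseteq> carrier M"
    using finite_gens f by (auto intro: countable_finite)
  from M.countable_closure[OF this] obtain C where C: "countable C" "f ` X \<subseteq> C"
      "C \<subseteq> carrier M" "\<one>\<^bsub>M\<^esub> \<in> C" and Cm: "\<And>x y. \<lbrakk>x \<in> C; y \<in> C\<rbrakk> \<Longrightarrow> x \<otimes>\<^bsub>M\<^esub> y \<in> C"
    by blast
  let ?g = "to_nat_on C"
  let ?i = "inv_into C ?g"
  define N :: "nat monoid" where
    "N = \<lparr>carrier = ?g ` C, mult = (\<lambda>a b. ?g (?i a \<otimes>\<^bsub>M\<^esub> ?i b)), one = ?g \<one>\<^bsub>M\<^esub>\<rparr>"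
  have inj: "inj_on ?g C" using C(1) by (rule inj_on_to_nat_on)
  have inv: "?i (?g c) = c" if "c \<in> C" for c using inv_into_f_f[OF inj that] .
  have CM: "c \<in> carrier M" if "c \<in> C" for c using C that by auto
  have comm: "c \<otimes>\<^bsub>M\<^esub> d = d \<otimes>\<^bsub>M\<^esub> c" if "c \<in> C" "d \<in> C" for c d
    using M.comm CM that by blast
  have "steiner_loop N"
  proof (rule steiner_loopI)
    fix x y assume "x \<in> carrier N" "y \<in> carrier N"
    then obtain c d where cd: "c \<in> C" "d \<in> C" "x = ?g c" "y = ?g d"
      by (auto simp: N_def)
    then show "x \<otimes>\<^bsub>N\<^esub> y \<in> carrier N" "x \<otimes>\<^bsub>N\<^esub> (x \<otimes>\<^bsub>N\<^esub> y) = y"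
      by (simp_all add: N_def inv Cm CM M.l_cancel_twice)
    from cd show "x \<otimes>\<^bsub>N\<^esub> y = y \<otimes>\<^bsub>N\<^esub> x"
      using comm[of c d] by (simp add: N_def inv)
  next
    show "\<one>\<^bsub>N\<^esub> \<in> carrier N" using C(4) by (simp add: N_def)
  next
    fix x assume "x \<in> carrier N"
    then obtain c where "c \<in> C" "x = ?g c" by (auto simp: N_def)
    then show "\<one>\<^bsub>N\<^esub> \<otimes>\<^bsub>N\<^esub> x = x" "x \<otimes>\<^bsub>N\<^esub> x = \<one>\<^bsub>N\<^esub>"
      using C(4) by (simp_all add: N_def inv CM M.l_one M.square)
  qed
  moreover have "(\<lambda>x. ?g (f x)) \<in> X \<rightarrow> carrier N" using C(2) by (auto simp: N_def)
  ultimately obtain h where h: "h \<in> hom L N" "\<forall>x \<in> X. h x = ?g (f x)"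
    using extension[of N "\<lambda>x. ?g (f x)"] by blast
  have hC: "h x \<in> ?g ` C" if "x \<in> carrier L" for x
    using h(1) that by (auto simp: hom_def N_def)
  have iC: "?i (h x) \<in> C" if "x \<in> carrier L" for x
    using hC[OF that] inv by auto
  have "?i (h (x \<otimes> y)) = ?i (h x) \<otimes>\<^bsub>M\<^esub> ?i (h y)" if "x \<in> carrier L" "y \<in> carrier L" for x y
  proof -
    have "h (x \<otimes> y) = ?g (?i (h x) \<otimes>\<^bsub>M\<^esub> ?i (h y))"
      using h(1) that by (simp add: hom_def N_def)
    then show ?thesis using inv Cm iC that by simp
  qed
  then have "(\<lambda>x. ?i (h x)) \<in> hom L M" using iC CM by (auto simp: hom_def)
  moreover have "\<forall>x \<in> X. ?i (h x) = f x" using h(2) C(2) inv by auto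
  ultimately show ?thesis by (intro bexI[of _ "\<lambda>x. ?i (h x)"])
qed

lemma (in free_steiner_loop) hom_eqI:
  assumes M: "steiner_loop M" and h: "h \<in> hom L M" "k \<in> hom L M"
    and eq: "\<forall>x \<in> X. h x = k x" and x: "x \<in> carrier L"
  shows "h x = k x"
proof -
  interpret M: steiner_loop M by (rule M)
  have one: "q \<one> = \<one>\<^bsub>M\<^esub>" if "q \<in> hom L M" for q
  proof -
    have "q \<one> = q (\<one> \<otimes> \<one>)" using one_closed by (simp add: l_one)
    also have "\<dots> = q \<one> \<otimes>\<^bsub>M\<^esub> q \<one>" using that one_closed by (auto simp: hom_def)
    also have "\<dots> = \<one>\<^bsub>M\<^esub>" using that one_closed by (intro M.square) (auto simp: hom_def)
    finally show ?thesis .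
  qed
  have "subloop {x \<in> carrier L. h x = k x} L"
    using h one[OF h(1)] one[OF h(2)]
    by (intro subloopI) (auto simp: hom_def one_closed m_closed)
  then have "generated_subloop L X \<subseteq> {x \<in> carrier L. h x = k x}"
    unfolding generated_subloop_def using eq gens_closed by auto
  then show ?thesis using generates x by auto
qed

lemma (in free_steiner_loop) unique_extension:
  fixes M :: "('b, 'n) monoid_scheme"
  assumes "steiner_loop M" and "f \<in> X \<rightarrow> carrier M"
  shows "\<exists>!h. h \<in> hom L M \<and> h \<in> extensional (carrier L) \<and> (\<forall>x \<in> X. h x = f x)"
proof -
  obtain h where h: "h \<in> hom L M" "\<forall>x \<in> X. h x = f x"
    using extension_any[OF assms] by blast
  show ?thesis
  proof (rule ex1I[of _ "restrict h (carrier L)"])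
    show "restrict h (carrier L) \<in> hom L M \<and> restrict h (carrier L) \<in> extensional (carrier L)
        \<and> (\<forall>x \<in> X. restrict h (carrier L) x = f x)"
      using h gens_closed by (auto simp: hom_def m_closed)
  next
    fix k assume k: "k \<in> hom L M \<and> k \<in> extensional (carrier L) \<and> (\<forall>x \<in> X. k x = f x)"
    then have "k x = h x" if "x \<in> carrier L" for x
      using hom_eqI[OF assms(1), of k h x] h that by auto
    then show "k = restrict h (carrier L)"
      using k by (auto simp: extensional_def restrict_def)
  qed
qed

(* On one or two free generators the free Steiner loop is a nontrivial group,
   hence equal to its nucleus and to its center. *)
lemma (in free_steiner_loop) nucleus_at_most_two_gens:
  assumes "card X = 1 \<or> card X = 2"
  shows "nucleus L = carrier L" "loop_center L = carrier L" "carrier L \<noteq> {\<one>}"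
proof -
  obtain x y where X: "X = {x, y}"
    using assms by (metis card_1_singletonE card_2_iff insert_absorb2)
  have xy: "x \<in> carrier L" "y \<in> carrier L" using gens_closed X by auto
  have yx: "y \<otimes> x = x \<otimes> y" using xy comm by blast
  have r1: "y \<otimes> (x \<otimes> y) = x" using l_cancel_twice[of y x] xy by (simp add: yx)
  have r2: "(x \<otimes> y) \<otimes> x = y" using comm[of "x \<otimes> y" x] xy by (simp add: m_closed l_cancel_twice)
  have r3: "(x \<otimes> y) \<otimes> y = x" using comm[of "x \<otimes> y" y] xy by (simp add: m_closed r1)
  note rules = yx r1 r2 r3 xy one_closed m_closed l_one r_one square l_cancel_twice
  have "subloop {\<one>, x, y, x \<otimes> y} L"
    by (rule subloopI) (auto simp: rules)
  then have "generated_subloop L X \<subseteq> {\<one>, x, y, x \<otimes> y}"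
    unfolding generated_subloop_def using X by blast
  then have L: "carrier L = {\<one>, x, y, x \<otimes> y}"
    using generates xy one_closed m_closed by auto
  have assoc: "(a \<otimes> b) \<otimes> c = a \<otimes> (b \<otimes> c)"
    if "a \<in> carrier L" "b \<in> carrier L" "c \<in> carrier L" for a b c
    using that unfolding L by (auto simp: rules)
  then show N: "nucleus L = carrier L"
    by (auto simp: nucleus_def left_nucleus_def right_nucleus_def middle_nucleus_def)
  show "loop_center L = carrier L"
    using N comm by (auto simp: loop_center_def commutant_def)
  define M :: "nat monoid" where
    "M = \<lparr>carrier = {0, 1}, mult = (\<lambda>a b. if a = b then 0 else 1), one = 0\<rparr>"
  have M: "steiner_loop M" by (rule steiner_loopI) (auto simp: M_def)
  then obtain h where h: "h \<in> hom L M" "h x = 1"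
    using extension[OF M, of "\<lambda>_. 1"] X by (auto simp: M_def)
  have "h \<one> = h \<one> \<otimes>\<^bsub>M\<^esub> h \<one>"
    using h(1) one_closed l_one by (auto simp: hom_def)
  then have "h \<one> = 0" by (simp add: M_def)
  then show "carrier L \<noteq> {\<one>}" using h(2) xy by auto
qed

end

(* The elements of a free Steiner loop are the reduced commutative nonassociative words in
   the generators, with the products a(ab) and aa cancelled. Given a word u other than the
   unit, choose a generator c that is neither u nor a factor of u, and a generator d distinct
   from u and c. If u lies in the nucleus, then u(c((uc)d)) = (uc)((uc)d) = d; but the word
   on the left is reduced, and it is not a generator. *)
theory Submission
  imports Defs "HOL-Library.Uprod"
begin

section \<open>Commutative nonassociative words, with unordered pairs as products\<close>

datatype 'a word = Unit | Gen 'a | Prod "'a word uprod"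

abbreviation pair :: "'a word \<Rightarrow> 'a word \<Rightarrow> 'a word" where
  "pair a b \<equiv> Prod (Upair a b)"

text \<open>Heights tell words apart: they rule out equalities such as \<open>a = pair a c\<close>
  and two words being factors of each other.\<close>

primrec height :: "'a word \<Rightarrow> nat" where
  "height Unit = 0"
| "height (Gen x) = 0"
| "height (Prod p) = Suc (Max (set_uprod (map_uprod height p)))"

lemma height_pair [simp]: "height (pair a b) = Suc (max (height a) (height b))"
  by simp

definition factor :: "'a word \<Rightarrow> 'a word \<Rightarrow> bool" where
  "factor a b \<longleftrightarrow> (\<exists>c. b = pair a c)"

lemma factor_simps [simp]:
  "\<not> factor a Unit" "\<not> factor a (Gen x)" "factor a (pair b c) \<longleftrightarrow> a = b \<or> a = c"
  by (auto simp: factor_def)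

lemma height_neq: "height a < height b \<Longrightarrow> a \<noteq> b"
  by auto

lemma height_factor: "factor a b \<Longrightarrow> height a < height b"
  by (auto simp: factor_def)

definition cofactor :: "'a word \<Rightarrow> 'a word \<Rightarrow> 'a word" where
  "cofactor a b = (THE c. b = pair a c)"

lemma cofactor_pair [simp]: "cofactor a (pair a c) = c" "cofactor a (pair c a) = c"
  by (auto simp: cofactor_def)

text \<open>\<open>Unit\<close> is left out so that it never occurs inside a product; the carrier of
  \<open>word_loop\<close> adds it back.\<close>

inductive_set reduced :: "'a set \<Rightarrow> 'a word set" for X where
  Gen: "x \<in> X \<Longrightarrow> Gen x \<in> reduced X"
| pair: "\<lbrakk>a \<in> reduced X; b \<in> reduced X; a \<noteq> b; \<not> factor a b; \<not> factor b a\<rbrakk>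
    \<Longrightarrow> pair a b \<in> reduced X"

lemma Unit_not_reduced [simp]: "Unit \<notin> reduced X"
  by (auto elim: reduced.cases)

lemma reduced_pairD:
  assumes "pair a b \<in> reduced X"
  shows "a \<in> reduced X" "b \<in> reduced X" "a \<noteq> b" "\<not> factor a b" "\<not> factor b a"
  by (rule reduced.cases[OF assms]; auto)+

section \<open>The Steiner loop of reduced words\<close>

definition word_mult :: "'a word \<Rightarrow> 'a word \<Rightarrow> 'a word" where
  "word_mult a b = (if a = Unit then b else if b = Unit then a else if a = b then Unit
     else if factor a b then cofactor a b else if factor b a then cofactor b a
     else pair a b)"

text \<open>By height, at most one of \<open>factor a b\<close> and \<open>factor b a\<close> holds,
  so the order in which the definition tests them does not matter.\<close>

lemma word_mult_commute: "word_mult a b = word_mult b a"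
  using height_factor[of a b] height_factor[of b a] by (auto simp: word_mult_def)

lemma word_mult_pair: "\<lbrakk>a \<noteq> Unit; b \<noteq> Unit; a \<noteq> b; \<not> factor a b; \<not> factor b a\<rbrakk>
    \<Longrightarrow> word_mult a b = pair a b"
  by (simp add: word_mult_def)

lemma word_mult_factor:
  assumes "pair a c \<in> reduced X"
  shows "word_mult a (pair a c) = c" "word_mult (pair a c) a = c"
proof -
  have "a \<noteq> Unit" using reduced_pairD(1)[OF assms] by auto
  moreover have "a \<noteq> pair a c" by (rule height_neq) simp
  ultimately show "word_mult a (pair a c) = c"
    by (simp add: word_mult_def)
  then show "word_mult (pair a c) a = c"
    by (simp add: word_mult_commute)
qed

lemma word_mult_cases [consumes 2, case_names eq right left pair]:
  assumes "a \<in> reduced X" "b \<in> reduced X"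
  obtains "a = b" | c where "b = pair a c" | c where "a = pair b c"
    | "a \<noteq> b" "\<not> factor a b" "\<not> factor b a" "word_mult a b = pair a b"
  using assms word_mult_pair[of a b] Unit_not_reduced unfolding factor_def by metis

definition word_loop :: "'a set \<Rightarrow> 'a word monoid" where
  "word_loop X = \<lparr>carrier = insert Unit (reduced X), mult = word_mult, one = Unit\<rparr>"

lemma word_loop_simps [simp]:
  "carrier (word_loop X) = insert Unit (reduced X)" "mult (word_loop X) = word_mult"
  "one (word_loop X) = Unit"
  by (simp_all add: word_loop_def)

lemma word_mult_Unit [simp]: "word_mult Unit a = a" "word_mult a Unit = a" "word_mult a a = Unit"
  by (auto simp: word_mult_def)

text \<open>A cancellation leaves a factor of a reduced word, which is again reduced, and a second
  multiplication by \<open>a\<close> restores \<open>b\<close>. Without cancellation the new pair is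
  reduced, and the second multiplication cancels it.\<close>

lemma word_mult_reduced:
  assumes "a \<in> reduced X" "b \<in> reduced X"
  shows "word_mult a b \<in> insert Unit (reduced X) \<and> word_mult a (word_mult a b) = b"
  using assms
proof (cases rule: word_mult_cases)
  case (right c)
  note r = reduced_pairD[OF assms(2)[unfolded right]]
  \<comment> \<open>The two factors of the reduced word \<open>b\<close> do not cancel against each
    other, so multiplying them rebuilds \<open>b\<close>.\<close>
  have "word_mult a c = pair a c"
    using r assms by (intro word_mult_pair) auto
  then show ?thesis
    using right assms r word_mult_factor[of a c X] by simp
next
  case (left c)
  note r = reduced_pairD[OF assms(1)[unfolded left]]
  \<comment> \<open>Swapping makes \<open>c\<close> the first factor, the one that
    \<open>word_mult_factor\<close> cancels.\<close>
  have "Upair c b = Upair b c" by simp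
  then have "word_mult (pair b c) c = b"
    using word_mult_factor(2)[of c b X] assms(1)[unfolded left] by metis
  then show ?thesis
    using left assms r word_mult_factor(2)[of b c X] by simp
next
  case pair
  then have "pair a b \<in> reduced X"
    using assms by (intro reduced.pair)
  then show ?thesis
    using pair word_mult_factor by auto
qed simp

lemma steiner_loop_word_loop: "steiner_loop (word_loop X)"
  by (rule steiner_loopI) (use word_mult_reduced word_mult_commute in auto)

(* The multiplication of L commutes only on the carrier, so it does not lift to unordered
   pairs as a total operation; SOME chooses an order of the factors. *)
primrec word_eval :: "('a, 'm) monoid_scheme \<Rightarrow> 'a word \<Rightarrow> 'a" where
  "word_eval L Unit = \<one>\<^bsub>L\<^esub>"
| "word_eval L (Gen x) = x"
| "word_eval L (Prod p) =
     (SOME r. \<exists>x y. map_uprod (word_eval L) p = Upair x y \<and> r = x \<otimes>\<^bsub>L\<^esub> y)"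

section \<open>Evaluation of words in a Steiner loop\<close>

context steiner_loop
begin

text \<open>Both orders of the factors give the same product by commutativity in the carrier, so the
  choice has a single candidate.\<close>

lemma word_eval_pair:
  assumes "word_eval L a \<in> carrier L" "word_eval L b \<in> carrier L"
  shows "word_eval L (pair a b) = word_eval L a \<otimes> word_eval L b"
proof -
  have "word_eval L (pair a b) = (SOME r. r = word_eval L a \<otimes> word_eval L b)"
    unfolding word_eval.simps map_uprod_simps
    by (rule arg_cong[where f = Eps]) (use assms comm in \<open>auto simp: fun_eq_iff\<close>)
  then show ?thesis by simp
qed

lemma word_eval_closed:
  assumes "X \<subseteq> carrier L" "w \<in> reduced X"
  shows "word_eval L w \<in> carrier L"
  using assms(2)
proof induction
  case (pair a b)
  then show ?case using m_closed word_eval_pair by simp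
qed (use assms(1) in auto)

text \<open>Every cancellation made by \<open>word_mult\<close> is also valid in \<open>L\<close>,
  by \<open>square\<close> or \<open>l_cancel_twice\<close>.\<close>

lemma word_eval_mult:
  assumes X: "X \<subseteq> carrier L" and ab: "a \<in> reduced X" "b \<in> reduced X"
  shows "word_eval L (word_mult a b) = word_eval L a \<otimes> word_eval L b"
  using ab
proof (cases rule: word_mult_cases)
  case eq
  then show ?thesis using word_eval_closed[OF X] ab square by simp
next
  case (right c)
  then have "a \<in> reduced X" "c \<in> reduced X" "word_mult a b = c"
    using ab reduced_pairD(2) word_mult_factor(1) by blast+
  then show ?thesis
    using right word_eval_closed[OF X] word_eval_pair l_cancel_twice by simp
next
  case (left c)
  then have c: "c \<in> reduced X" "word_mult a b = c"
    using ab reduced_pairD(2) word_mult_factor(2)[of b c X] word_mult_commute[of a b]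
    by simp_all
  have "word_eval L a \<otimes> word_eval L b = word_eval L b \<otimes> word_eval L a"
    using word_eval_closed[OF X] ab comm by simp
  then show ?thesis
    using left c ab word_eval_closed[OF X] word_eval_pair l_cancel_twice by simp
next
  case pair
  then show ?thesis using word_eval_closed[OF X] word_eval_pair ab by simp
qed

lemma word_eval_hom:
  assumes "X \<subseteq> carrier L"
  shows "word_eval L \<in> hom (word_loop X) L"
  using word_eval_mult[OF assms] word_eval_closed[OF assms] one_closed l_one r_one
  by (auto simp: hom_def)

lemma one_in_nucleus: "\<one> \<in> nucleus L"
  by (auto simp: nucleus_def left_nucleus_def right_nucleus_def middle_nucleus_def
      one_closed m_closed l_one r_one)

lemma one_in_center: "\<one> \<in> loop_center L"
  using one_in_nucleus by (auto simp: loop_center_def commutant_def one_closed l_one r_one)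

end

text \<open>None of the four products cancels. The hypotheses on \<open>c\<close> and
  \<open>d\<close> settle the inner ones; in the outermost one \<open>u\<close> is too low to equal
  the big word or its compound factor. The result is therefore a pair.\<close>

lemma word_mult_not_Gen:
  assumes "u \<noteq> Unit" "u \<noteq> Gen c" "\<not> factor (Gen c) u" "u \<noteq> Gen d" "c \<noteq> d"
  shows "word_mult u (word_mult (Gen c) (word_mult (word_mult u (Gen c)) (Gen d))) \<noteq> Gen d"
proof -
  let ?v = "pair u (Gen c)" and ?c = "Gen c"
  have uc: "word_mult u ?c = ?v"
    using assms by (intro word_mult_pair) auto
  have y: "word_mult ?v (Gen d) = pair ?v (Gen d)"
    using assms by (intro word_mult_pair) auto
  have cy: "word_mult ?c (pair ?v (Gen d)) = pair ?c (pair ?v (Gen d))"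
    using assms by (intro word_mult_pair) auto
  have big: "height u < height ?v" "height u < height (pair ?v (Gen d))"
    "height u < height (pair ?c (pair ?v (Gen d)))"
    by simp_all
  have "word_mult u (pair ?c (pair ?v (Gen d))) = pair u (pair ?c (pair ?v (Gen d)))"
  proof (rule word_mult_pair)
    show "\<not> factor u (pair ?c (pair ?v (Gen d)))"
      using assms(2) height_neq[OF big(2)] by simp
    show "\<not> factor (pair ?c (pair ?v (Gen d))) u"
      using big(3) height_factor by fastforce
  qed (use assms(1) height_neq[OF big(3)] in simp_all)
  then show ?thesis by (simp add: uc y cy)
qed

section \<open>Triviality of the left nucleus\<close>

context free_steiner_loop
begin

text \<open>Evaluation after \<open>h\<close> is an endomorphism of \<open>L\<close> that fixes the
  generators, hence the identity. So \<open>h\<close> is injective on the carrier, and equations of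
  \<open>L\<close> can be tested on words.\<close>

lemma word_hom:
  obtains h where "h \<in> hom L (word_loop X)" "\<And>x. x \<in> X \<Longrightarrow> h x = Gen x"
    "\<And>x. x \<in> carrier L \<Longrightarrow> word_eval L (h x) = x"
proof -
  obtain h where h: "h \<in> hom L (word_loop X)" "\<forall>x\<in>X. h x = Gen x"
    using extension_any[OF steiner_loop_word_loop, of Gen X] by (auto intro: reduced.Gen)
  have "(word_eval L \<circ> h) x = id x" if "x \<in> carrier L" for x
  proof (rule hom_eqI[OF steiner_loop_axioms _ _ _ that])
    show "word_eval L \<circ> h \<in> hom L L"
      using h(1) word_eval_hom[OF gens_closed] by (rule hom_compose)
  qed (use h(2) in \<open>auto simp: hom_def\<close>)
  then show ?thesis using that[of h] h by simp
qed

lemma left_nucleus_trivial: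
  assumes "card X \<ge> 3" and u: "u \<in> left_nucleus L"
  shows "u = \<one>"
proof (rule ccontr)
  assume "u \<noteq> \<one>"
  obtain h where h: "h \<in> hom L (word_loop X)" "\<And>x. x \<in> X \<Longrightarrow> h x = Gen x"
    "\<And>x. x \<in> carrier L \<Longrightarrow> word_eval L (h x) = x"
    by (rule word_hom) blast
  have uL: "u \<in> carrier L"
    and assoc: "\<And>x y. \<lbrakk>x \<in> carrier L; y \<in> carrier L\<rbrakk> \<Longrightarrow> (u \<otimes> x) \<otimes> y = u \<otimes> (x \<otimes> y)"
    using u by (auto simp: left_nucleus_def)
  have hU: "h u \<noteq> Unit"
    using h(3)[OF uL] \<open>u \<noteq> \<one>\<close> by auto
  have avoid: "\<exists>z\<in>X. z \<noteq> a \<and> z \<noteq> b" for a b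
  proof (rule ccontr)
    assume "\<not> ?thesis"
    then have "X \<subseteq> {a, b}" by auto
    then have "card X \<le> card {a, b}" by (intro card_mono) auto
    also have "\<dots> \<le> 2" by (simp add: card_insert_if)
    finally show False using assms(1) by simp
  qed
  \<comment> \<open>A word has at most two factors, so at most two generators are forbidden as
    \<open>c\<close>; a third one remains.\<close>
  have "\<exists>a b. \<forall>z. h u = Gen z \<or> factor (Gen z) (h u) \<longrightarrow> z = a \<or> z = b"
  proof (cases "h u")
    case (Prod p)
    obtain s t where "p = Upair s t" by (cases p) auto
    \<comment> \<open>If \<open>s\<close> is not a generator, its \<open>case\<close> value is
      unspecified, but then \<open>s = Gen z\<close> cannot hold; likewise for
      \<open>t\<close>.\<close>
    with Prod have "\<forall>z. h u = Gen z \<or> factor (Gen z) (h u) \<longrightarrow>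
        z = (case s of Gen x \<Rightarrow> x) \<or> z = (case t of Gen x \<Rightarrow> x)"
      by (auto split: word.split)
    then show ?thesis by blast
  qed auto
  then obtain c where c: "c \<in> X" "h u \<noteq> Gen c" "\<not> factor (Gen c) (h u)"
    using avoid by metis
  obtain d where d: "d \<in> X" "c \<noteq> d" "h u \<noteq> Gen d"
    \<comment> \<open>If \<open>h u\<close> is not a generator, the second avoided value is
      arbitrary and \<open>h u \<noteq> Gen d\<close> holds anyway.\<close>
    using avoid[of c "case h u of Gen x \<Rightarrow> x"] by (auto split: word.splits)
  have L: "c \<in> carrier L" "d \<in> carrier L"
    using c(1) d(1) gens_closed by auto
  have hm: "h (x \<otimes> y) = word_mult (h x) (h y)" if "x \<in> carrier L" "y \<in> carrier L" for x y
    using h(1) that by (simp add: hom_def)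
  have "u \<otimes> (c \<otimes> ((u \<otimes> c) \<otimes> d)) = d"
    using assoc[of c "(u \<otimes> c) \<otimes> d"] l_cancel_twice[of "u \<otimes> c" d] uL L m_closed by simp
  then have "word_mult (h u) (word_mult (Gen c) (word_mult (word_mult (h u) (Gen c)) (Gen d))) = Gen d"
    using hm h(2) c(1) d(1) uL L m_closed by metis
  with word_mult_not_Gen[OF hU c(2,3) d(3,2)] show False by blast
qed

lemma carrier_no_gens:
  assumes "X = {}"
  shows "carrier L = {\<one>}"
proof -
  have "subloop {\<one>} L"
    by (rule subloopI) (auto simp: one_closed l_one)
  then have "generated_subloop L X \<subseteq> {\<one>}"
    using assms by (auto simp: generated_subloop_def)
  then show ?thesis using generates one_closed by auto
qed

end

theorem corollary4:
  fixes L :: "('a, 'm) monoid_scheme" and X :: "'a set"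
  assumes "free_steiner_loop L X"
    and "card X \<noteq> 1" and "card X \<noteq> 2"
  shows "nucleus L = {\<one>\<^bsub>L\<^esub>} \<and> loop_center L = {\<one>\<^bsub>L\<^esub>}"
proof -
  interpret free_steiner_loop L X by (rule assms(1))
  have "u = \<one>\<^bsub>L\<^esub>" if u: "u \<in> left_nucleus L" for u
  proof (cases "X = {}")
    case True
    with u carrier_no_gens show ?thesis by (auto simp: left_nucleus_def)
  next
    case False
    \<comment> \<open>Finiteness matters here, since \<open>card\<close> is also 0 on infinite
      sets.\<close>
    then have "card X \<noteq> 0" using finite_gens by simp
    with assms(2,3) have "card X \<ge> 3" by linarith
    then show ?thesis using u by (rule left_nucleus_trivial)
  qed
  then have "nucleus L \<subseteq> {\<one>\<^bsub>L\<^esub>}" by (auto simp: nucleus_def)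
  moreover have "loop_center L \<subseteq> nucleus L" by (auto simp: loop_center_def)
  ultimately show ?thesis using one_in_nucleus one_in_center by blast
qed

end
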